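(* Consider the network revenue management model and Algorithm 2 defined in the context, run with start time $1$, end time $T$ and initial capacity $C$, and let $V^{\mathrm{ALG2}}$ be its revenue. In the asymptotic regime $T\to\infty$ (with $C_i$ proportional to $T$), the regret of Algorithm 2 satisfies $$\mathbf E[V^{\mathrm{HO}}-V^{\mathrm{ALG2}}]=O\big(\sqrt T(\log T)^{\frac12}\big).$$
   Context: **Model.** $[k]=\{1,\dots,k\}$. There are $T$ periods, $n$ customer types and $m$ resources. In each period $t\in[T]$ exactly one customer arrives, of type $j(t)$, where $j(1),\dots,j(T)$ are i.i.d. with $\mathbf P(j(t)=j)=\lambda_j$, $\sum_{j}\lambda_j=1$. $\Lambda_j(s_1,s_2)$ is the number of type-$j$ arrivals in periods $s_1,\dots,s_2$. Resource $i$ has initial capacity $C_i>0$, $C=(C_1,\dots,C_m)^\top$. Accepting a type-$j$ customer yields revenue $r_j\ge 0$ and consumes $a_{ij}\ge 0$ units of each resource $i$; $A_j=(a_{1j},\dots,a_{mj})^\top$. Every row and every column of $A=[A_1,\dots,A_n]$ has a nonzero entry. Accept/reject decisions are made online and irrevocably. The revenue of an algorithm is the sum of $r_{j(t)}$ over accepted customers. Vector inequalities are componentwise. **Hindsight optimum.** $V^{\mathrm{HO}}=\max\{\sum_j r_jz_j : \sum_jA_jz_j\le C,\ 0\le z_j\le\Lambda_j(1,T)\ \forall j\}$. **Asymptotic regime.** $n,m,\lambda,r,A$ are fixed, and $T=k\bar T$, $C_i=k\bar C_i$ with $\bar T,\bar C_i>0$ fixed and $k\to\infty$. **Algorithm 2**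 with start time $1$, end time $T$, capacity $C$. Put $C_{\max}=\max_iC_i$, $C_{\min}=\min_iC_i$, $\bar\alpha_i=\max_{j:a_{ij}\ne0}r_j/a_{ij}$, $\bar\theta=\frac{C_{\max}}{C_{\min}}\sum_{i=1}^m\bar\alpha_i$, $\bar a=\max_{i,j}a_{ij}$, $D=\bar\theta\sqrt m$, $G=\frac{C_{\max}}{T}\sqrt m+\bar a\sqrt m$. Start with $\theta^{(1)}=0\in\mathbb R^m$, $B(1)=C$. For $t=1,\dots,T$: observe $j(t)$ and set $y_t=\mathbf 1\big(r_{j(t)}>\sum_i\theta^{(t)}_ia_{i,j(t)}\big)$. If $A_j\le B(t)$ fails for some $j\in[n]$, stop (all later customers are rejected). Otherwise accept iff $y_t=1$, set $B(t+1)=B(t)-y_tA_{j(t)}$, and update $\theta^{(t+1)}_i=\min\{\max\{0,\ \theta^{(t)}_i-\eta_t(\frac{C_i}{T}-y_ta_{i,j(t)})\},\bar\theta\}$ for all $i$, where $\eta_t=\frac{D}{G\sqrt t}$. *)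

theory Defs
  imports "HOL-Probability.Probability" "HOL-Library.Landau_Symbols"
begin

text \<open>
  Customer types are the elements of a finite type \<open>'n\<close>, resources those of a finite type \<open>'m\<close>.
  The consumption matrix \<open>A\<close> has entries \<open>A $ i $ j\<close> (resource \<open>i\<close>, type \<open>j\<close>), so the
  vector \<open>A\<^sub>j\<close> is \<open>column j A\<close>; \<open>\<le>\<close> on vectors is componentwise. An arrival
  sequence is a function \<open>x\<close>, with \<open>x t\<close> the type arriving in period \<open>t\<close>, for
  \<open>t = 1, 2, \<dots>\<close>; the value \<open>x 0\<close> is never used.
\<close>

definition arrivals :: "(nat \<Rightarrow> 'n) \<Rightarrow> nat \<Rightarrow> nat \<Rightarrow> 'n \<Rightarrow> nat" where
  "arrivals x s1 s2 j = card {t \<in> {s1..s2}. x t = j}"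

definition hindsight_feasible ::
  "real^'n^'m \<Rightarrow> real^'m \<Rightarrow> nat \<Rightarrow> (nat \<Rightarrow> 'n) \<Rightarrow> (real^'n) set" where
  "hindsight_feasible A C T x =
     {z. A *v z \<le> C \<and> (\<forall>j. 0 \<le> z $ j \<and> z $ j \<le> real (arrivals x 1 T j))}"

text \<open>The supremum is a maximum; see \<open>hindsight_optimum_attained\<close> below.\<close>

definition hindsight_optimum ::
  "real^'n \<Rightarrow> real^'n^'m \<Rightarrow> real^'m \<Rightarrow> nat \<Rightarrow> (nat \<Rightarrow> 'n) \<Rightarrow> real" where
  "hindsight_optimum r A C T x =
     (SUP z \<in> hindsight_feasible A C T x. \<Sum>j\<in>UNIV. r $ j * z $ j)"

lemma hindsight_optimum_attained:
  fixes r :: "real^'n" and A :: "real^'n^'m" and C :: "real^'m"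
  assumes "\<forall>i. 0 \<le> C $ i"
  shows "\<exists>z \<in> hindsight_feasible A C T x.
           hindsight_optimum r A C T x = (\<Sum>j\<in>UNIV. r $ j * z $ j) \<and>
           (\<forall>z' \<in> hindsight_feasible A C T x.
              (\<Sum>j\<in>UNIV. r $ j * z' $ j) \<le> (\<Sum>j\<in>UNIV. r $ j * z $ j))"
proof -
  let ?F = "hindsight_feasible A C T x" and ?f = "\<lambda>z::real^'n. \<Sum>j\<in>UNIV. r $ j * z $ j"
  have F: "?F = {z. \<forall>i. (\<Sum>j\<in>UNIV. A $ i $ j * z $ j) \<le> C $ i} \<inter>
              cbox 0 (\<chi> j. real (arrivals x 1 T j))"
    by (auto simp: hindsight_feasible_def less_eq_vec_def matrix_vector_mult_def mem_box_cart)
  have "closed {z::real^'n. \<forall>i. (\<Sum>j\<in>UNIV. A $ i $ j * z $ j) \<le> C $ i}"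
    by (intro closed_Collect_all closed_Collect_le continuous_intros)
  then have "compact ?F"
    unfolding F by (intro closed_Int_compact compact_cbox)
  moreover have "0 \<in> ?F"
    using assms by (auto simp: hindsight_feasible_def less_eq_vec_def)
  moreover have "continuous_on ?F ?f"
    by (intro continuous_intros)
  ultimately obtain z where z: "z \<in> ?F" "\<forall>z' \<in> ?F. ?f z' \<le> ?f z"
    using continuous_attains_sup[of ?F ?f] by blast
  then have "hindsight_optimum r A C T x = ?f z"
    unfolding hindsight_optimum_def by (intro cSup_eq_maximum) auto
  with z show ?thesis by blast
qed

definition C_max :: "real^'m \<Rightarrow> real" where
  "C_max C = (MAX i\<in>UNIV. C $ i)"

definition C_min :: "real^'m \<Rightarrow> real" where
  "C_min C = (MIN i\<in>UNIV. C $ i)"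

definition alpha_bar :: "real^'n \<Rightarrow> real^'n^'m \<Rightarrow> 'm \<Rightarrow> real" where
  "alpha_bar r A i = (MAX j\<in>{j. A $ i $ j \<noteq> 0}. r $ j / A $ i $ j)"

definition theta_bar :: "real^'n \<Rightarrow> real^'n^'m \<Rightarrow> real^'m \<Rightarrow> real" where
  "theta_bar r A C = C_max C / C_min C * (\<Sum>i\<in>UNIV. alpha_bar r A i)"

definition a_bar :: "real^'n^'m \<Rightarrow> real" where
  "a_bar A = (MAX (i, j)\<in>UNIV. A $ i $ j)"

definition D_param :: "real^'n \<Rightarrow> real^'n^'m \<Rightarrow> real^'m \<Rightarrow> real" where
  "D_param r A C = theta_bar r A C * sqrt (real CARD('m))"

definition G_param :: "real^'n^'m \<Rightarrow> real^'m \<Rightarrow> nat \<Rightarrow> real" where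
  "G_param A C T = C_max C / real T * sqrt (real CARD('m)) + a_bar A * sqrt (real CARD('m))"

definition step_size :: "real^'n \<Rightarrow> real^'n^'m \<Rightarrow> real^'m \<Rightarrow> nat \<Rightarrow> nat \<Rightarrow> real" where
  "step_size r A C T t = D_param r A C / (G_param A C T * sqrt (real t))"

definition alg2_running :: "real^'n^'m \<Rightarrow> real^'m \<Rightarrow> bool" where
  "alg2_running A B \<longleftrightarrow> (\<forall>j. column j A \<le> B)"

definition alg2_y :: "real^'n \<Rightarrow> real^'n^'m \<Rightarrow> real^'m \<Rightarrow> 'n \<Rightarrow> real" where
  "alg2_y r A \<theta> j = of_bool (r $ j > (\<Sum>i\<in>UNIV. \<theta> $ i * A $ i $ j))"

text \<open>
  \<open>alg2_state r A C T x t\<close> is the pair \<open>(\<theta>, B)\<close> of dual prices and remaining capacities after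
  \<open>t\<close> periods, i.e. at the start of period \<open>t + 1\<close>. When the capacity test fails the pair is
  left unchanged, so the test also fails in every later period: the algorithm has stopped.
\<close>

primrec alg2_state ::
  "real^'n \<Rightarrow> real^'n^'m \<Rightarrow> real^'m \<Rightarrow> nat \<Rightarrow> (nat \<Rightarrow> 'n) \<Rightarrow> nat \<Rightarrow> (real^'m) \<times> (real^'m)" where
  "alg2_state r A C T x 0 = (0, C)"
| "alg2_state r A C T x (Suc t) =
     (let (\<theta>, B) = alg2_state r A C T x t;
          j = x (Suc t);
          y = alg2_y r A \<theta> j
      in if alg2_running A B
         then (\<chi> i. min (max 0 (\<theta> $ i - step_size r A C T (Suc t) * (C $ i / real T - y * A $ i $ j)))
                        (theta_bar r A C),
               B - y *\<^sub>R column j A)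
         else (\<theta>, B))"

definition alg2_revenue ::
  "real^'n \<Rightarrow> real^'n^'m \<Rightarrow> real^'m \<Rightarrow> nat \<Rightarrow> (nat \<Rightarrow> 'n) \<Rightarrow> real" where
  "alg2_revenue r A C T x =
     (\<Sum>t = 1..T. case alg2_state r A C T x (t - 1) of (\<theta>, B) \<Rightarrow>
        if alg2_running A B \<and> alg2_y r A \<theta> (x t) = 1 then r $ x t else 0)"

end

theory Submission
  imports Defs
begin

text \<open>
  The price update is projected online gradient descent on the sampled Lagrangian dual
  \<open>dual_cost \<theta> j = \<theta> \<bullet> (C / T) + max 0 (r\<^sub>j - \<theta> \<bullet> A\<^sub>j)\<close>. While the algorithm is running, the revenue
  of a period is the dual cost at the current price minus \<open>\<theta> \<bullet> g\<close>, with \<open>g\<close> the gradient. By weak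
  duality, and since the price is independent of the next arrival, each running period contributes
  at least \<open>v = E V\<^sup>H\<^sup>O / T\<close> in expected dual cost. The terms \<open>\<theta> \<bullet> g\<close> are compared with
  a fixed price: with \<open>0\<close> if capacity lasts, and with \<open>theta_bar\<close> times the \<open>i\<close>-th unit vector if
  resource \<open>i\<close> runs out. Because \<open>theta_bar C\<^sub>i / T \<ge> v\<close>, the latter pays for all periods after the
  stop. What remains is the gradient descent regret and a constant, hence the stronger bound
  \<open>O(sqrt T)\<close>.
\<close>

section \<open>Projected gradient descent in one coordinate\<close>

lemma clip_contraction:
  fixes z u b :: real
  assumes "0 \<le> u" "u \<le> b"
  shows "(min (max 0 z) b - u)\<^sup>2 \<le> (z - u)\<^sup>2"
proof -
  have "\<bar>min (max 0 z) b - u\<bar> \<le> \<bar>z - u\<bar>"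
    using assms by (auto simp: min_def max_def abs_if)
  then show ?thesis
    by (simp add: abs_le_square_iff)
qed

text \<open>The steps shrink like \<open>1 / sqrt (real (Suc t))\<close>, so the squared distance to
  \<open>u\<close> is weighted by the reciprocal of the step. The growth of this weight and the
  squared gradients each add up to a multiple of \<open>sqrt (real s)\<close>.\<close>

lemma online_gradient_regret:
  fixes th g :: "nat \<Rightarrow> real"
  assumes eta: "0 < \<eta>" and u: "0 \<le> u" "u \<le> b"
    and th0: "0 \<le> th 0" "th 0 \<le> b"
    and step: "\<And>t. th (Suc t) = min (max 0 (th t - \<eta> / sqrt (real (Suc t)) * g t)) b"
    and g: "\<And>t. \<bar>g t\<bar> \<le> L"
  shows "(\<Sum>t<s. (th t - u) * g t) \<le> (b\<^sup>2 / (2 * \<eta>) + \<eta> * L\<^sup>2) * sqrt (real s)"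
proof -
  have range: "0 \<le> th t \<and> th t \<le> b" for t
    using th0 u by (cases t) (auto simp: step)
  \<comment> \<open>The weighted distance stays on the left as a potential so that the induction
    closes; being nonnegative, it is dropped at the end.\<close>
  have "(\<Sum>t<s. (th t - u) * g t) + sqrt (real s) / (2 * \<eta>) * (th s - u)\<^sup>2
      \<le> (b\<^sup>2 / (2 * \<eta>) + \<eta> * L\<^sup>2) * sqrt (real s)"
  proof (induction s)
    case (Suc s)
    define p where "p = sqrt (real s)"
    define q where "q = sqrt (real (Suc s))"
    have q: "0 < q" "0 \<le> p" "p \<le> q" and qp: "q\<^sup>2 = p\<^sup>2 + 1"
      by (auto simp: p_def q_def)
    \<comment> \<open>Turns the coefficient of the squared gradient into a telescoping difference of
      roots.\<close>
    have inv: "1 / (2 * q) \<le> q - p"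
    proof -
      have "1 = (q - p) * (q + p)"
        using qp by (simp add: power2_eq_square algebra_simps)
      also have "\<dots> \<le> (q - p) * (2 * q)"
        using q by (intro mult_left_mono) auto
      finally show ?thesis
        using q by (simp add: field_simps)
    qed
    have "(th (Suc s) - u)\<^sup>2 \<le> (th s - \<eta> / q * g s - u)\<^sup>2"
      unfolding step q_def by (rule clip_contraction[OF u])
    \<comment> \<open>With this weight the cross term of the expanded square is exactly the summand
      \<open>(th s - u) * g s\<close>.\<close>
    then have "q / (2 * \<eta>) * (th (Suc s) - u)\<^sup>2 \<le> q / (2 * \<eta>) * (th s - \<eta> / q * g s - u)\<^sup>2"
      using q eta by (intro mult_left_mono) auto
    also have "\<dots> = q / (2 * \<eta>) * (th s - u)\<^sup>2 - (th s - u) * g s + \<eta> * (g s)\<^sup>2 * (1 / (2 * q))"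
      using q eta by (simp add: field_simps power2_eq_square)
    also have "\<dots> \<le> q / (2 * \<eta>) * (th s - u)\<^sup>2 - (th s - u) * g s + \<eta> * L\<^sup>2 * (q - p)"
    proof -
      have "(g s)\<^sup>2 \<le> L\<^sup>2"
        using g[of s] by (simp add: abs_le_square_iff[symmetric])
      then have "\<eta> * (g s)\<^sup>2 * (1 / (2 * q)) \<le> \<eta> * L\<^sup>2 * (q - p)"
        using inv eta q by (intro mult_mono) auto
      then show ?thesis by simp
    qed
    finally have 1: "q / (2 * \<eta>) * (th (Suc s) - u)\<^sup>2
      \<le> q / (2 * \<eta>) * (th s - u)\<^sup>2 - (th s - u) * g s + \<eta> * L\<^sup>2 * (q - p)" .
    \<comment> \<open>Raising the weight from \<open>p\<close> to \<open>q\<close> is paid for by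
      the diameter \<open>b\<close> of the interval.\<close>
    have "\<bar>th s - u\<bar> \<le> \<bar>b\<bar>"
      using range[of s] u by (auto simp: abs_if)
    then have "(th s - u)\<^sup>2 \<le> b\<^sup>2"
      by (simp add: abs_le_square_iff)
    then have "(q - p) / (2 * \<eta>) * (th s - u)\<^sup>2 \<le> (q - p) / (2 * \<eta>) * b\<^sup>2"
      using q eta by (intro mult_left_mono) auto
    then have "q / (2 * \<eta>) * (th s - u)\<^sup>2 - p / (2 * \<eta>) * (th s - u)\<^sup>2
        \<le> b\<^sup>2 / (2 * \<eta>) * q - b\<^sup>2 / (2 * \<eta>) * p"
      by (simp add: diff_divide_distrib algebra_simps)
    with 1 Suc.IH show ?case
      unfolding p_def[symmetric] q_def[symmetric] sum.lessThan_Suc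
      by (simp add: algebra_simps)
  qed simp
  moreover have "0 \<le> sqrt (real s) / (2 * \<eta>) * (th s - u)\<^sup>2"
    using eta by simp
  ultimately show ?thesis by linarith
qed

text \<open>Links the hindsight program, stated with type counts, to sums over periods. Periods are
  shifted to \<open>{..<T}\<close> because state \<open>t\<close> precedes arrival
  \<open>Suc t\<close>.\<close>

lemma arrivals_sum:
  fixes x :: "nat \<Rightarrow> 'n::finite" and h :: "'n \<Rightarrow> real"
  shows "(\<Sum>j\<in>UNIV. real (arrivals x 1 T j) * h j) = (\<Sum>t<T. h (x (Suc t)))"
proof -
  have "real (arrivals x 1 T j) = (\<Sum>t<T. of_bool (x (Suc t) = j))" for j
  proof -
    have "real (arrivals x 1 T j) = (\<Sum>t = 1..T. of_bool (x t = j))"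
      unfolding arrivals_def by (simp add: Int_def)
    then show ?thesis
      by (simp add: sum.atLeast1_atMost_eq)
  qed
  then have "(\<Sum>j\<in>UNIV. real (arrivals x 1 T j) * h j) = (\<Sum>j\<in>UNIV. \<Sum>t<T. of_bool (x (Suc t) = j) * h j)"
    by (simp add: sum_distrib_right)
  also have "\<dots> = (\<Sum>t<T. \<Sum>j\<in>UNIV. of_bool (x (Suc t) = j) * h j)"
    by (rule sum.swap)
  also have "\<dots> = (\<Sum>t<T. h (x (Suc t)))"
    by (simp add: of_bool_def if_distrib[of "\<lambda>a. a * _"] cong: if_cong)
  finally show ?thesis .
qed

section \<open>The model on a fixed arrival path\<close>

locale revenue_model =
  fixes r :: "real^'n" and A :: "real^'n^'m" and C :: "real^'m" and T :: nat
  assumes r_nonneg: "0 \<le> r $ j"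
    and A_nonneg: "0 \<le> A $ i $ j"
    and rows: "\<exists>j. A $ i $ j \<noteq> 0"
    and columns: "\<exists>i. A $ i $ j \<noteq> 0"
    and C_pos: "0 < C $ i"
    and T_pos: "0 < T"
begin

abbreviation price :: "(nat \<Rightarrow> 'n) \<Rightarrow> nat \<Rightarrow> real^'m" where
  "price x t \<equiv> fst (alg2_state r A C T x t)"

abbreviation stock :: "(nat \<Rightarrow> 'n) \<Rightarrow> nat \<Rightarrow> real^'m" where
  "stock x t \<equiv> snd (alg2_state r A C T x t)"

text \<open>A real 0/1 factor, so that sums up to the random stopping period become weighted sums
  over all \<open>t < T\<close>. Index \<open>t\<close> refers to period \<open>t + 1\<close>, here
  and below.\<close>

definition run :: "(nat \<Rightarrow> 'n) \<Rightarrow> nat \<Rightarrow> real" where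
  "run x t = of_bool (alg2_running A (stock x t))"

definition accept :: "(nat \<Rightarrow> 'n) \<Rightarrow> nat \<Rightarrow> real" where
  "accept x t = run x t * alg2_y r A (price x t) (x (Suc t))"

definition grad :: "(nat \<Rightarrow> 'n) \<Rightarrow> nat \<Rightarrow> 'm \<Rightarrow> real" where
  "grad x t i = run x t * (C $ i / real T) - accept x t * A $ i $ x (Suc t)"

definition dual_cost :: "real^'m \<Rightarrow> 'n \<Rightarrow> real" where
  "dual_cost \<theta> j = (\<Sum>i\<in>UNIV. \<theta> $ i * (C $ i / real T)) + max 0 (r $ j - (\<Sum>i\<in>UNIV. \<theta> $ i * A $ i $ j))"

abbreviation "\<theta>max \<equiv> theta_bar r A C"
abbreviation "\<eta> \<equiv> D_param r A C / G_param A C T"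

text \<open>The constant of \<open>online_gradient_regret\<close> for the price interval
  \<open>{0..\<theta>max}\<close> and the gradient bound \<open>G_param A C T\<close>.\<close>

definition coord_regret :: real where
  "coord_regret = \<theta>max\<^sup>2 / (2 * \<eta>) + \<eta> * (G_param A C T)\<^sup>2"

section \<open>Signs and bounds of the parameters\<close>

lemma run_01: "run x t = 0 \<or> run x t = 1"
  by (simp add: run_def)

lemma alg2_y_01: "alg2_y r A \<theta> j = 0 \<or> alg2_y r A \<theta> j = 1"
  by (simp add: alg2_y_def)

lemma accept_01: "accept x t = 0 \<or> accept x t = 1"
  using run_01[of x t] alg2_y_01[of "price x t" "x (Suc t)"] by (auto simp: accept_def)

lemma accept_bounds: "0 \<le> accept x t" "accept x t \<le> 1"
  using accept_01[of x t] by auto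

lemma C_le_max: "C $ i \<le> C_max C"
  by (simp add: C_max_def)

lemma C_ge_min: "C_min C \<le> C $ i"
  by (simp add: C_min_def)

lemma C_min_pos: "0 < C_min C"
  by (simp add: C_min_def C_pos)

lemma C_max_pos: "0 < C_max C"
  using C_pos[of undefined] C_le_max[of undefined] by linarith

lemma A_le_a_bar: "A $ i $ j \<le> a_bar A"
  unfolding a_bar_def by (rule Max_ge) (auto intro!: image_eqI[of _ _ "(i, j)"])

lemma a_bar_nonneg: "0 \<le> a_bar A"
  using A_nonneg A_le_a_bar order_trans by blast

lemma ratio_le_alpha: "A $ i $ j \<noteq> 0 \<Longrightarrow> r $ j / A $ i $ j \<le> alpha_bar r A i"
  unfolding alpha_bar_def by (rule Max_ge) auto

lemma alpha_nonneg: "0 \<le> alpha_bar r A i"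
  using rows[of i] ratio_le_alpha r_nonneg A_nonneg by (meson divide_nonneg_nonneg order_trans)

lemma theta_bar_nonneg: "0 \<le> \<theta>max"
  unfolding theta_bar_def using C_max_pos C_min_pos alpha_nonneg
  by (intro mult_nonneg_nonneg sum_nonneg) (auto intro: less_imp_le)

lemma G_pos: "0 < G_param A C T"
  unfolding G_param_def using C_max_pos a_bar_nonneg T_pos
  by (intro add_pos_nonneg mult_nonneg_nonneg) auto

lemma \<eta>_nonneg: "0 \<le> \<eta>"
  using theta_bar_nonneg G_pos by (simp add: D_param_def)

lemma coord_regret_nonneg: "0 \<le> coord_regret"
proof -
  have "0 \<le> b\<^sup>2 / (2 * e) + e * g\<^sup>2" if "0 \<le> e" for b e g :: real
    using that by simp
  from this[OF \<eta>_nonneg] show ?thesis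
    unfolding coord_regret_def .
qed

section \<open>Evolution of prices and stock\<close>

lemma price_Suc:
  "price x (Suc t) $ i = min (max 0 (price x t $ i - \<eta> / sqrt (real (Suc t)) * grad x t i)) \<theta>max"
  and price_range: "0 \<le> price x t $ i \<and> price x t $ i \<le> \<theta>max"
proof -
  have range: "0 \<le> price x t $ i \<and> price x t $ i \<le> \<theta>max" for t
    by (induction t) (auto simp: theta_bar_nonneg split_beta Let_def)
  then show "0 \<le> price x t $ i \<and> price x t $ i \<le> \<theta>max" .
  show "price x (Suc t) $ i = min (max 0 (price x t $ i - \<eta> / sqrt (real (Suc t)) * grad x t i)) \<theta>max"
    \<comment> \<open>After the stop \<open>grad\<close> is zero and clipping fixes a price already
      in range, so one recursion covers both phases.\<close>
    using range[of t] by (auto simp: split_beta Let_def run_def grad_def accept_def step_size_def)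
qed

lemma stock_Suc: "stock x (Suc t) = stock x t - accept x t *\<^sub>R column (x (Suc t)) A"
  by (auto simp: split_beta Let_def run_def accept_def)

lemma stock_eq: "stock x t $ i = C $ i - (\<Sum>s<t. accept x s * A $ i $ x (Suc s))"
  by (induction t) (simp_all add: stock_Suc column_def del: alg2_state.simps(2))

text \<open>The capacity test demands room for every type, so no acceptance can overdraw a
  resource.\<close>

lemma stock_nonneg: "0 \<le> stock x t $ i"
proof (induction t)
  case (Suc t)
  show ?case
  proof (cases "alg2_running A (stock x t)")
    case True
    then have "A $ i $ x (Suc t) \<le> stock x t $ i"
      by (auto simp: alg2_running_def less_eq_vec_def column_def)
    with Suc accept_01[of x t] show ?thesis
      by (auto simp: stock_Suc column_def simp del: alg2_state.simps(2))
  next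
    case False
    with Suc show ?thesis
      by (simp add: stock_Suc accept_def run_def del: alg2_state.simps(2))
  qed
qed (simp add: C_pos less_imp_le)

lemma run_antimono:
  assumes "s \<le> t"
  shows "run x t \<le> run x s"
proof (rule lift_Suc_antimono_le[OF _ assms])
  show "run x (Suc t) \<le> run x t" for t
    by (cases "alg2_running A (stock x t)") (auto simp: run_def split_beta)
qed

text \<open>A difference of two nonnegative terms is at most the larger one in modulus, and each is
  bounded by one summand of \<open>G_param\<close>.\<close>

lemma grad_bound: "\<bar>grad x t i\<bar> \<le> G_param A C T"
proof -
  have m: "1 \<le> sqrt (real CARD('m))"
    by simp
  have 1: "0 \<le> C $ i / real T" "C $ i / real T \<le> C_max C / real T * sqrt (real CARD('m))"
  proof -
    show "0 \<le> C $ i / real T"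
      using C_pos[of i] by simp
    have "C $ i / real T \<le> C_max C / real T * 1"
      using C_le_max by (simp add: divide_right_mono)
    also have "\<dots> \<le> C_max C / real T * sqrt (real CARD('m))"
      using C_max_pos m by (intro mult_left_mono) auto
    finally show "C $ i / real T \<le> C_max C / real T * sqrt (real CARD('m))" .
  qed
  have 2: "0 \<le> A $ i $ x (Suc t)" "A $ i $ x (Suc t) \<le> a_bar A * sqrt (real CARD('m))"
  proof -
    show "0 \<le> A $ i $ x (Suc t)"
      by (rule A_nonneg)
    have "a_bar A * 1 \<le> a_bar A * sqrt (real CARD('m))"
      using a_bar_nonneg m by (intro mult_left_mono) auto
    with A_le_a_bar[of i "x (Suc t)"] show "A $ i $ x (Suc t) \<le> a_bar A * sqrt (real CARD('m))"
      by simp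
  qed
  show ?thesis
    using run_01[of x t] accept_01[of x t] 1 2 unfolding grad_def G_param_def by auto
qed

section \<open>Regret of the prices and exhausted capacity\<close>

lemma coordinate_regret:
  assumes u: "0 \<le> u" "u \<le> \<theta>max"
  shows "(\<Sum>t<s. price x t $ i * grad x t i) \<le> coord_regret * sqrt (real s) + u * (\<Sum>t<s. grad x t i)"
proof (cases "\<theta>max = 0")
  \<comment> \<open>Here \<open>\<eta>\<close> is zero and \<open>online_gradient_regret\<close>
    does not apply, but all prices are zero as well.\<close>
  case True
  then have "price x t $ i = 0" for t
    using price_range[of x t i] by simp
  moreover have "0 \<le> coord_regret * sqrt (real s)"
    using coord_regret_nonneg by simp
  ultimately show ?thesis
    using True u by simp
next
  case False
  then have "0 < \<eta>"
    using theta_bar_nonneg G_pos by (simp add: D_param_def)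
  from online_gradient_regret[OF this u, of "\<lambda>t. price x t $ i" "\<lambda>t. grad x t i", OF _ _ price_Suc grad_bound, of s]
  have "(\<Sum>t<s. (price x t $ i - u) * grad x t i) \<le> coord_regret * sqrt (real s)"
    using price_range[of x 0 i] by (simp add: coord_regret_def)
  then show ?thesis
    by (simp add: algebra_simps sum_subtractf sum_distrib_left)
qed

lemma complementarity_bound:
  assumes v: "\<And>i. v \<le> \<theta>max * (C $ i / real T)"
  shows "(\<Sum>t<T. \<Sum>i\<in>UNIV. price x t $ i * grad x t i)
    \<le> real CARD('m) * coord_regret * sqrt (real T) + \<theta>max * a_bar A - (real T - (\<Sum>t<T. run x t)) * v"
proof (cases "alg2_running A (stock x T)")
  \<comment> \<open>The test is read after the last period: if it passes, no period was cut off. The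
    other case may still have all \<open>T\<close> periods running.\<close>
  case True
  have "run x t = 1" if "t < T" for t
    using run_antimono[of t T x] that True by (auto simp: run_def of_bool_def split: if_splits)
  then have "(\<Sum>t<T. run x t) = real T"
    by simp
  moreover have "(\<Sum>i\<in>UNIV. \<Sum>t<T. price x t $ i * grad x t i) \<le> (\<Sum>i\<in>(UNIV::'m set). coord_regret * sqrt (real T))"
    using coordinate_regret[of 0] theta_bar_nonneg by (intro sum_mono) auto
  moreover have "0 \<le> \<theta>max * a_bar A"
    using theta_bar_nonneg a_bar_nonneg by simp
  ultimately show ?thesis
    by (subst sum.swap) simp
next
  case False
  \<comment> \<open>A failed test exhibits a resource with less than \<open>a_bar A\<close>
    left.\<close>
  then obtain i j where ij: "stock x T $ i < A $ i $ j"
    by (auto simp: alg2_running_def less_eq_vec_def column_def not_le)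
  define u where "u i' = (if i' = i then \<theta>max else 0)" for i'
  define \<tau> where "\<tau> = (\<Sum>t<T. run x t)"
  have "\<tau> \<le> (\<Sum>t<T. 1)"
    unfolding \<tau>_def using run_01 by (intro sum_mono) (metis order.refl zero_le_one)
  then have \<tau>: "0 \<le> real T - \<tau>"
    by simp
  \<comment> \<open>Budget released at rate \<open>C $ i / real T\<close> over the running periods,
    minus actual consumption, which is nearly all of \<open>C $ i\<close>.\<close>
  have "(\<Sum>t<T. grad x t i) = \<tau> * (C $ i / real T) - (C $ i - stock x T $ i)"
    by (simp add: grad_def sum_subtractf stock_eq \<tau>_def sum_distrib_right del: times_divide_eq_right)
  also have "\<dots> \<le> \<tau> * (C $ i / real T) - C $ i + a_bar A"
    using ij A_le_a_bar[of i j] by simp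
  also have "\<dots> = a_bar A - (real T - \<tau>) * (C $ i / real T)"
    using T_pos by (simp add: field_simps)
  finally have "\<theta>max * (\<Sum>t<T. grad x t i) \<le> \<theta>max * (a_bar A - (real T - \<tau>) * (C $ i / real T))"
    by (rule mult_left_mono) (rule theta_bar_nonneg)
  also have "\<dots> = \<theta>max * a_bar A - (real T - \<tau>) * (\<theta>max * (C $ i / real T))"
    by (simp add: algebra_simps)
  \<comment> \<open>Each of the \<open>real T - \<tau>\<close> stopped periods is credited with at
    least \<open>v\<close>.\<close>
  also have "\<dots> \<le> \<theta>max * a_bar A - (real T - \<tau>) * v"
    using mult_left_mono[OF v[of i] \<tau>] by simp
  finally have u_le: "\<theta>max * (\<Sum>t<T. grad x t i) \<le> \<theta>max * a_bar A - (real T - \<tau>) * v" .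
  have "(\<Sum>i'\<in>UNIV. \<Sum>t<T. price x t $ i' * grad x t i')
      \<le> (\<Sum>i'\<in>UNIV. coord_regret * sqrt (real T) + u i' * (\<Sum>t<T. grad x t i'))"
    using theta_bar_nonneg by (intro sum_mono coordinate_regret) (auto simp: u_def)
  also have "\<dots> = real CARD('m) * coord_regret * sqrt (real T) + \<theta>max * (\<Sum>t<T. grad x t i)"
  proof -
    have "(\<Sum>i'\<in>UNIV. u i' * (\<Sum>t<T. grad x t i')) = (\<Sum>i'\<in>UNIV. if i' = i then \<theta>max * (\<Sum>t<T. grad x t i') else 0)"
      by (intro sum.cong) (auto simp: u_def)
    then show ?thesis
      by (simp add: sum.distrib)
  qed
  finally show ?thesis
    using u_le unfolding \<tau>_def by (subst sum.swap) simp
qed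

section \<open>Revenue in terms of the dual cost\<close>

lemma revenue_eq: "alg2_revenue r A C T x = (\<Sum>t<T. accept x t * r $ x (Suc t))"
proof -
  have "alg2_revenue r A C T x = (\<Sum>t<T. case alg2_state r A C T x t of (\<theta>, B) \<Rightarrow>
        if alg2_running A B \<and> alg2_y r A \<theta> (x (Suc t)) = 1 then r $ x (Suc t) else 0)"
    by (simp add: alg2_revenue_def sum.atLeast1_atMost_eq)
  also have "\<dots> = (\<Sum>t<T. accept x t * r $ x (Suc t))"
    by (intro sum.cong) (auto simp: split_beta accept_def run_def alg2_y_def)
  finally show ?thesis .
qed

text \<open>The decision \<open>alg2_y\<close> attains the maximum in \<open>dual_cost\<close>: it
  is 1 exactly when the reduced revenue is positive. After the stop both sides are zero.\<close>

lemma accept_revenue_split: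
  "accept x t * r $ x (Suc t)
    = run x t * dual_cost (price x t) (x (Suc t)) - (\<Sum>i\<in>UNIV. price x t $ i * grad x t i)"
proof -
  have "(\<Sum>i\<in>UNIV. price x t $ i * grad x t i)
      = run x t * (\<Sum>i\<in>UNIV. price x t $ i * (C $ i / real T))
        - accept x t * (\<Sum>i\<in>UNIV. price x t $ i * A $ i $ x (Suc t))"
    by (simp add: grad_def sum_distrib_left sum_subtractf[symmetric] algebra_simps)
  then show ?thesis
    by (auto simp: dual_cost_def accept_def run_def alg2_y_def max_def algebra_simps)
qed

text \<open>Subtracting \<open>v\<close> isolates a sum that is nonnegative in expectation; the
  credit for stopped periods completes the total \<open>real T * v\<close>.\<close>

lemma revenue_lower_bound:
  assumes "\<And>i. v \<le> \<theta>max * (C $ i / real T)"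
  shows "(\<Sum>t<T. run x t * (dual_cost (price x t) (x (Suc t)) - v)) + real T * v
      - (real CARD('m) * coord_regret * sqrt (real T) + \<theta>max * a_bar A)
    \<le> alg2_revenue r A C T x"
proof -
  have "alg2_revenue r A C T x = (\<Sum>t<T. run x t * dual_cost (price x t) (x (Suc t)))
      - (\<Sum>t<T. \<Sum>i\<in>UNIV. price x t $ i * grad x t i)"
    by (simp add: revenue_eq accept_revenue_split sum_subtractf)
  moreover have "(\<Sum>t<T. run x t * (dual_cost (price x t) (x (Suc t)) - v))
      = (\<Sum>t<T. run x t * dual_cost (price x t) (x (Suc t))) - (\<Sum>t<T. run x t) * v"
    by (simp add: right_diff_distrib sum_subtractf sum_distrib_right)
  ultimately show ?thesis
    using complementarity_bound[OF assms, of x] by (simp add: left_diff_distrib)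
qed

section \<open>Bounds on the hindsight optimum\<close>

lemma optimum_attained:
  obtains z where "z \<in> hindsight_feasible A C T x"
    "hindsight_optimum r A C T x = (\<Sum>j\<in>UNIV. r $ j * z $ j)"
  using hindsight_optimum_attained[of C A T x r] C_pos by (meson less_imp_le)

lemma feasible_le_optimum:
  assumes "z \<in> hindsight_feasible A C T x"
  shows "(\<Sum>j\<in>UNIV. r $ j * z $ j) \<le> hindsight_optimum r A C T x"
proof -
  have "\<forall>i. 0 \<le> C $ i"
    using C_pos by (simp add: less_imp_le)
  then show ?thesis
    using hindsight_optimum_attained[of C A T x r] assms by auto
qed

text \<open>Split the value of an optimal \<open>z\<close> into reduced revenue and priced
  consumption. Arrival counts bound the first part, capacities the second.\<close>

lemma weak_duality:
  assumes \<theta>: "\<And>i. 0 \<le> \<theta> $ i"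
  shows "hindsight_optimum r A C T x \<le> (\<Sum>t<T. dual_cost \<theta> (x (Suc t)))"
proof -
  obtain z where z: "z \<in> hindsight_feasible A C T x"
    and opt: "hindsight_optimum r A C T x = (\<Sum>j\<in>UNIV. r $ j * z $ j)"
    by (rule optimum_attained)
  define c where "c j = (\<Sum>i\<in>UNIV. \<theta> $ i * A $ i $ j)" for j
  from z have cap: "(\<Sum>j\<in>UNIV. A $ i $ j * z $ j) \<le> C $ i"
    and zj: "0 \<le> z $ j" "z $ j \<le> real (arrivals x 1 T j)" for i j
    by (auto simp: hindsight_feasible_def less_eq_vec_def matrix_vector_mult_def)
  have "(\<Sum>j\<in>UNIV. r $ j * z $ j) = (\<Sum>j\<in>UNIV. z $ j * (r $ j - c j)) + (\<Sum>j\<in>UNIV. z $ j * c j)"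
    by (simp add: sum.distrib[symmetric] algebra_simps)
  also have "(\<Sum>j\<in>UNIV. z $ j * c j) = (\<Sum>i\<in>UNIV. \<theta> $ i * (\<Sum>j\<in>UNIV. A $ i $ j * z $ j))"
    unfolding c_def sum_distrib_left by (subst sum.swap) (simp add: mult_ac)
  also have "(\<Sum>i\<in>UNIV. \<theta> $ i * (\<Sum>j\<in>UNIV. A $ i $ j * z $ j)) \<le> (\<Sum>i\<in>UNIV. \<theta> $ i * C $ i)"
    by (intro sum_mono mult_left_mono cap \<theta>)
  also have "(\<Sum>j\<in>UNIV. z $ j * (r $ j - c j)) \<le> (\<Sum>j\<in>UNIV. real (arrivals x 1 T j) * max 0 (r $ j - c j))"
  proof (rule sum_mono)
    fix j
    have "z $ j * (r $ j - c j) \<le> z $ j * max 0 (r $ j - c j)"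
      using zj by (intro mult_left_mono) auto
    also have "\<dots> \<le> real (arrivals x 1 T j) * max 0 (r $ j - c j)"
      using zj by (intro mult_right_mono) auto
    finally show "z $ j * (r $ j - c j) \<le> real (arrivals x 1 T j) * max 0 (r $ j - c j)" .
  qed
  also have "\<dots> = (\<Sum>t<T. max 0 (r $ x (Suc t) - c (x (Suc t))))"
    by (rule arrivals_sum)
  also have "(\<Sum>i\<in>UNIV. \<theta> $ i * C $ i) = (\<Sum>t<T. \<Sum>i\<in>UNIV. \<theta> $ i * (C $ i / real T))"
    using T_pos by (simp add: sum_divide_distrib[symmetric])
  finally show ?thesis
    by (simp add: opt dual_cost_def c_def sum.distrib)
qed

text \<open>Explains the size of \<open>theta_bar\<close>: the prices \<open>alpha_bar\<close> cover
  every revenue, so the optimum is at most \<open>C_max C\<close> times their sum, and the factor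
  \<open>C_max C / C_min C\<close> makes the bound hold with any single capacity.\<close>

lemma optimum_le_theta_bar: "hindsight_optimum r A C T x \<le> \<theta>max * C $ i"
proof -
  obtain z where z: "z \<in> hindsight_feasible A C T x"
    and opt: "hindsight_optimum r A C T x = (\<Sum>j\<in>UNIV. r $ j * z $ j)"
    by (rule optimum_attained)
  from z have cap: "(\<Sum>j\<in>UNIV. A $ i $ j * z $ j) \<le> C $ i" and zj: "0 \<le> z $ j" for i j
    by (auto simp: hindsight_feasible_def less_eq_vec_def matrix_vector_mult_def)
  have "r $ j \<le> (\<Sum>i\<in>UNIV. alpha_bar r A i * A $ i $ j)" for j
  proof -
    obtain i where i: "A $ i $ j \<noteq> 0"
      using columns by blast
    with A_nonneg[of i j] ratio_le_alpha[OF i] have "r $ j \<le> alpha_bar r A i * A $ i $ j"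
      by (simp add: field_simps)
    also have "\<dots> \<le> (\<Sum>i\<in>UNIV. alpha_bar r A i * A $ i $ j)"
      by (rule member_le_sum) (auto intro!: mult_nonneg_nonneg alpha_nonneg A_nonneg)
    finally show ?thesis .
  qed
  then have "(\<Sum>j\<in>UNIV. r $ j * z $ j) \<le> (\<Sum>j\<in>UNIV. (\<Sum>i\<in>UNIV. alpha_bar r A i * A $ i $ j) * z $ j)"
    using zj by (intro sum_mono mult_right_mono) auto
  also have "\<dots> = (\<Sum>i\<in>UNIV. alpha_bar r A i * (\<Sum>j\<in>UNIV. A $ i $ j * z $ j))"
    unfolding sum_distrib_left sum_distrib_right by (subst sum.swap) (simp add: mult_ac)
  also have "\<dots> \<le> (\<Sum>i\<in>UNIV. alpha_bar r A i * C_max C)"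
    by (intro sum_mono mult_left_mono alpha_nonneg order_trans[OF cap C_le_max])
  also have "\<dots> = \<theta>max * C_min C"
    using C_min_pos by (simp add: theta_bar_def sum_distrib_right[symmetric])
  also have "\<dots> \<le> \<theta>max * C $ i"
    by (intro mult_left_mono C_ge_min theta_bar_nonneg)
  finally show ?thesis
    using opt by simp
qed

text \<open>The accepted customers form a feasible hindsight solution. With regret nonnegative, an
  upper bound on it also bounds its absolute value.\<close>

lemma revenue_le_optimum: "alg2_revenue r A C T x \<le> hindsight_optimum r A C T x"
proof -
  define z :: "real^'n" where "z = (\<chi> j. \<Sum>t<T. accept x t * of_bool (x (Suc t) = j))"
  have sum_z: "(\<Sum>j\<in>UNIV. h j * z $ j) = (\<Sum>t<T. accept x t * h (x (Suc t)))" for h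
  proof -
    have "(\<Sum>j\<in>UNIV. h j * z $ j) = (\<Sum>j\<in>UNIV. \<Sum>t<T. if x (Suc t) = j then accept x t * h j else 0)"
      unfolding z_def vec_lambda_beta sum_distrib_left by (intro sum.cong refl) simp
    also have "\<dots> = (\<Sum>t<T. \<Sum>j\<in>UNIV. if x (Suc t) = j then accept x t * h j else 0)"
      by (rule sum.swap)
    finally show ?thesis by simp
  qed
  have "z \<in> hindsight_feasible A C T x"
  proof -
    have "(\<Sum>j\<in>UNIV. A $ i $ j * z $ j) \<le> C $ i" for i
      using stock_nonneg[of x T i] unfolding sum_z by (simp add: stock_eq)
    moreover have "0 \<le> z $ j" for j
      unfolding z_def vec_lambda_beta using accept_bounds by (intro sum_nonneg) auto
    moreover have "z $ j \<le> real (arrivals x 1 T j)" for j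
    proof -
      have "z $ j \<le> (\<Sum>t<T. of_bool (x (Suc t) = j))"
        unfolding z_def vec_lambda_beta using accept_bounds by (intro sum_mono) auto
      also have "\<dots> = real (arrivals x 1 T j)"
        using arrivals_sum[of x T "\<lambda>j'. if j' = j then 1 else 0"]
        by (simp add: of_bool_def if_distrib[of "\<lambda>a. _ * a"] cong: if_cong)
      finally show ?thesis .
    qed
    ultimately show ?thesis
      by (auto simp: hindsight_feasible_def less_eq_vec_def matrix_vector_mult_def)
  qed
  moreover have "alg2_revenue r A C T x = (\<Sum>j\<in>UNIV. r $ j * z $ j)"
    unfolding sum_z by (rule revenue_eq)
  ultimately show ?thesis
    using feasible_le_optimum by simp
qed

text \<open>The algorithm is non-anticipating; this is what makes the price independent of the next
  arrival.\<close>

lemma state_cong: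
  assumes "\<And>s. s \<in> {1..t} \<Longrightarrow> x s = x' s"
  shows "alg2_state r A C T x t = alg2_state r A C T x' t"
  using assms by (induction t) (auto simp: split_beta Let_def)

lemma optimum_cong:
  assumes "\<And>s. s \<in> {1..T} \<Longrightarrow> x s = x' s"
  shows "hindsight_optimum r A C T x = hindsight_optimum r A C T x'"
proof -
  have "{t \<in> {1..T}. x t = j} = {t \<in> {1..T}. x' t = j}" for j
    using assms by auto
  then have "arrivals x 1 T = arrivals x' 1 T"
    by (intro ext) (simp only: arrivals_def)
  then show ?thesis
    by (simp add: hindsight_optimum_def hindsight_feasible_def)
qed

end

section \<open>Expectations over finitely many arrivals\<close>

locale iid_arrivals = prob_space M for M :: "'w measure" +
  fixes J :: "nat \<Rightarrow> 'w \<Rightarrow> 'n::finite" and lam :: "'n \<Rightarrow> real"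
  assumes indep: "indep_vars (\<lambda>_. count_space UNIV) J {1..}"
    and law: "\<And>t j. 1 \<le> t \<Longrightarrow> prob {\<omega> \<in> space M. J t \<omega> = j} = lam j"
begin

text \<open>For finite \<open>I\<close> such a functional factors through a finite space of
  restricted paths, where every function is measurable and bounded.\<close>

definition determined_by :: "nat set \<Rightarrow> ((nat \<Rightarrow> 'n) \<Rightarrow> real) \<Rightarrow> bool" where
  "determined_by I F \<longleftrightarrow> (\<forall>x x'. (\<forall>t\<in>I. x t = x' t) \<longrightarrow> F x = F x')"

lemma determined_by_restrict: "determined_by I F \<Longrightarrow> F (restrict x I) = F x"
  unfolding determined_by_def by (metis restrict_apply')

lemma measurable_PiM_finite:
  "finite I \<Longrightarrow> F \<in> PiM I (\<lambda>_. count_space (UNIV :: 'n set)) \<rightarrow>\<^sub>M borel"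
  by (subst count_space_PiM_finite) auto

lemma measurable_J: "t \<in> {1..} \<Longrightarrow> J t \<in> M \<rightarrow>\<^sub>M count_space UNIV"
  using indep unfolding indep_vars_def by blast

lemma integrable_path:
  fixes F :: "(nat \<Rightarrow> 'n) \<Rightarrow> real"
  assumes F: "determined_by {1..s} F"
  shows "integrable M (\<lambda>\<omega>. F (\<lambda>t. J t \<omega>))"
proof -
  have eq: "F (\<lambda>t. J t \<omega>) = F (\<lambda>t\<in>{1..s}. J t \<omega>)" for \<omega>
    using determined_by_restrict[OF F] by simp
  have "(\<lambda>\<omega>. \<lambda>t\<in>{1..s}. J t \<omega>) \<in> M \<rightarrow>\<^sub>M PiM {1..s} (\<lambda>_. count_space UNIV)"
    by (intro measurable_restrict measurable_J) auto
  from measurable_compose[OF this measurable_PiM_finite[of "{1..s}" F]]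
  have "(\<lambda>\<omega>. F (\<lambda>t. J t \<omega>)) \<in> borel_measurable M"
    unfolding eq by simp
  moreover have "\<bar>F (\<lambda>t. J t \<omega>)\<bar> \<le> Max ((\<lambda>x. \<bar>F x\<bar>) ` PiE {1..s} (\<lambda>_. UNIV))" for \<omega>
    unfolding eq by (intro Max_ge finite_imageI finite_PiE imageI) auto
  ultimately show ?thesis
    by (intro integrable_const_bound) auto
qed

text \<open>Averages out the next arrival given the past without conditional expectations: expand
  over the value of the next arrival and factor each product by independence.\<close>

lemma expectation_next_arrival:
  assumes F: "\<And>j. determined_by {1..s} (\<lambda>x. F x j)"
  shows "expectation (\<lambda>\<omega>. F (\<lambda>t. J t \<omega>) (J (Suc s) \<omega>))
    = expectation (\<lambda>\<omega>. \<Sum>j\<in>UNIV. lam j * F (\<lambda>t. J t \<omega>) j)"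
proof -
  have ind: "integrable M (\<lambda>\<omega>. of_bool (J (Suc s) \<omega> = j) :: real)" for j
    using integrable_path[of "Suc s" "\<lambda>x. of_bool (x (Suc s) = j)"] by (simp add: determined_by_def)
  have "integrable M (\<lambda>\<omega>. F (\<lambda>t. J t \<omega>) j * of_bool (J (Suc s) \<omega> = j))
      \<and> expectation (\<lambda>\<omega>. F (\<lambda>t. J t \<omega>) j * of_bool (J (Suc s) \<omega> = j))
        = expectation (\<lambda>\<omega>. F (\<lambda>t. J t \<omega>) j) * lam j" for j
  proof -
    \<comment> \<open>Past and next arrival are disjoint blocks of the independent family; for
      \<open>s = 0\<close> the past block is empty.\<close>
    have "indep_var
        (PiM {1..s} (\<lambda>_. count_space UNIV)) (\<lambda>\<omega>. \<lambda>t\<in>{1..s}. J t \<omega>)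
        (PiM {Suc s} (\<lambda>_. count_space UNIV)) (\<lambda>\<omega>. \<lambda>t\<in>{Suc s}. J t \<omega>)"
      by (rule indep_var_restrict[OF indep]) auto
    from indep_var_compose[OF this measurable_PiM_finite[of _ "\<lambda>x. F x j"]
        measurable_PiM_finite[of _ "\<lambda>x. of_bool (x (Suc s) = j) :: real"]]
    have iv: "indep_var borel (\<lambda>\<omega>. F (\<lambda>t. J t \<omega>) j) borel (\<lambda>\<omega>. of_bool (J (Suc s) \<omega> = j) :: real)"
      unfolding comp_def determined_by_restrict[OF F] by simp
    have "expectation (\<lambda>\<omega>. of_bool (J (Suc s) \<omega> = j)) = lam j"
    proof -
      have "expectation (\<lambda>\<omega>. of_bool (J (Suc s) \<omega> = j) :: real)
          = expectation (indicator {\<omega> \<in> space M. J (Suc s) \<omega> = j})"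
        by (intro Bochner_Integration.integral_cong) (auto simp: indicator_def)
      also have "\<dots> = prob ({\<omega> \<in> space M. J (Suc s) \<omega> = j} \<inter> space M)"
        by (rule Bochner_Integration.integral_indicator)
      also have "{\<omega> \<in> space M. J (Suc s) \<omega> = j} \<inter> space M = {\<omega> \<in> space M. J (Suc s) \<omega> = j}"
        by auto
      finally show ?thesis
        using law[of "Suc s" j] by simp
    qed
    then show ?thesis
      using indep_var_lebesgue_integral[OF iv integrable_path[OF F] ind]
        indep_var_integrable[OF iv integrable_path[OF F] ind] by simp
  qed
  note * = this
  have "F x j = (\<Sum>j'\<in>UNIV. F x j' * of_bool (j = j'))" for x j
    by simp
  then have "expectation (\<lambda>\<omega>. F (\<lambda>t. J t \<omega>) (J (Suc s) \<omega>))
      = expectation (\<lambda>\<omega>. \<Sum>j\<in>UNIV. F (\<lambda>t. J t \<omega>) j * of_bool (J (Suc s) \<omega> = j))"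
    by metis
  also have "\<dots> = (\<Sum>j\<in>UNIV. expectation (\<lambda>\<omega>. F (\<lambda>t. J t \<omega>) j) * lam j)"
    using * by (subst Bochner_Integration.integral_sum) auto
  also have "\<dots> = expectation (\<lambda>\<omega>. \<Sum>j\<in>UNIV. lam j * F (\<lambda>t. J t \<omega>) j)"
    using integrable_path[OF F] by (subst Bochner_Integration.integral_sum) (auto simp: mult.commute)
  finally show ?thesis .
qed

end

section \<open>Regret in expectation\<close>

locale revenue_management = revenue_model r A C T + iid_arrivals M J lam
  for r :: "real^'n" and A :: "real^'n^'m" and C T
    and M :: "'w measure" and J :: "nat \<Rightarrow> 'w \<Rightarrow> 'n" and lam
begin

abbreviation path :: "'w \<Rightarrow> nat \<Rightarrow> 'n" where
  "path \<omega> \<equiv> \<lambda>t. J t \<omega>"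

lemma determined_optimum: "determined_by {1..T} (hindsight_optimum r A C T)"
  unfolding determined_by_def using optimum_cong by blast

lemma determined_step:
  assumes "t < T"
  shows "determined_by {1..T} (\<lambda>x. run x t * h (price x t) (x (Suc t)))"
  unfolding determined_by_def
proof (intro allI impI)
  fix x x' :: "nat \<Rightarrow> 'n"
  assume *: "\<forall>s\<in>{1..T}. x s = x' s"
  have "alg2_state r A C T x t = alg2_state r A C T x' t"
    using * assms by (intro state_cong) auto
  moreover have "x (Suc t) = x' (Suc t)"
    using * assms by auto
  ultimately show "run x t * h (price x t) (x (Suc t)) = run x' t * h (price x' t) (x' (Suc t))"
    by (simp add: run_def)
qed

lemma determined_revenue: "determined_by {1..T} (alg2_revenue r A C T)"
proof -
  have "alg2_revenue r A C T x = (\<Sum>t<T. run x t * (alg2_y r A (price x t) (x (Suc t)) * r $ x (Suc t)))" for x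
    by (simp add: revenue_eq accept_def mult.assoc)
  then show ?thesis
    using determined_step[of _ "\<lambda>\<theta> j. alg2_y r A \<theta> j * r $ j"]
    unfolding determined_by_def by (auto intro!: sum.cong)
qed

text \<open>For a fixed price all periods have the same expected dual cost, so weak duality averages
  to one term per period.\<close>

lemma expected_optimum_le_dual:
  assumes "\<And>i. 0 \<le> \<theta> $ i"
  shows "expectation (\<lambda>\<omega>. hindsight_optimum r A C T (path \<omega>)) \<le> real T * (\<Sum>j\<in>UNIV. lam j * dual_cost \<theta> j)"
proof -
  have int: "integrable M (\<lambda>\<omega>. dual_cost \<theta> (J (Suc t) \<omega>))" for t
    using integrable_path[of "Suc t" "\<lambda>x. dual_cost \<theta> (x (Suc t))"] by (simp add: determined_by_def)
  have "expectation (\<lambda>\<omega>. hindsight_optimum r A C T (path \<omega>))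
      \<le> expectation (\<lambda>\<omega>. \<Sum>t<T. dual_cost \<theta> (J (Suc t) \<omega>))"
    using int weak_duality[OF assms]
    by (intro integral_mono integrable_path[OF determined_optimum] Bochner_Integration.integrable_sum) auto
  also have "\<dots> = (\<Sum>t<T. expectation (\<lambda>\<omega>. dual_cost \<theta> (J (Suc t) \<omega>)))"
    using int by (intro Bochner_Integration.integral_sum) auto
  also have "\<dots> = (\<Sum>t<T. \<Sum>j\<in>UNIV. lam j * dual_cost \<theta> j)"
  proof (intro sum.cong refl)
    fix t
    show "expectation (\<lambda>\<omega>. dual_cost \<theta> (J (Suc t) \<omega>)) = (\<Sum>j\<in>UNIV. lam j * dual_cost \<theta> j)"
      using expectation_next_arrival[of t "\<lambda>_. dual_cost \<theta>"]
      by (simp add: determined_by_def prob_space)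
  qed
  finally show ?thesis by simp
qed

lemma regret_bound:
  assumes lam_sum: "(\<Sum>j\<in>UNIV. lam j) = 1"
  shows "expectation (\<lambda>\<omega>. hindsight_optimum r A C T (path \<omega>) - alg2_revenue r A C T (path \<omega>))
    \<le> real CARD('m) * coord_regret * sqrt (real T) + \<theta>max * a_bar A" (is "_ \<le> ?R")
proof -
  let ?V = "expectation (\<lambda>\<omega>. hindsight_optimum r A C T (path \<omega>))"
  \<comment> \<open>The expected optimum per period is the benchmark for each running
    period.\<close>
  define v where "v = ?V / real T"
  define h where "h \<theta> j = dual_cost \<theta> j - v" for \<theta> j
  have v: "v \<le> \<theta>max * (C $ i / real T)" for i
  proof -
    have "?V \<le> expectation (\<lambda>_. \<theta>max * C $ i)"
      by (intro integral_mono integrable_path[OF determined_optimum] optimum_le_theta_bar) simp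
    then show ?thesis
      unfolding v_def using T_pos by (simp add: prob_space divide_right_mono)
  qed
  have step_int: "integrable M (\<lambda>\<omega>. run (path \<omega>) t * h (price (path \<omega>) t) (J (Suc t) \<omega>))" if "t < T" for t
    using integrable_path[OF determined_step[OF that, of h]] by simp
  have step_nonneg: "0 \<le> expectation (\<lambda>\<omega>. run (path \<omega>) t * h (price (path \<omega>) t) (J (Suc t) \<omega>))" for t
  proof -
    have "0 \<le> expectation (\<lambda>\<omega>. \<Sum>j\<in>UNIV. lam j * (run (path \<omega>) t * h (price (path \<omega>) t) j))"
    proof (rule Bochner_Integration.integral_nonneg)
      fix \<omega>
      \<comment> \<open>As \<open>v\<close> is a constant and the dual bound holds for every
        nonnegative price, it may be used at the realised price of each
        \<open>\<omega>\<close>.\<close>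
      have "v \<le> (\<Sum>j\<in>UNIV. lam j * dual_cost (price (path \<omega>) t) j)"
        unfolding v_def using expected_optimum_le_dual[of "price (path \<omega>) t"] price_range T_pos
        by (simp add: field_simps)
      also have "\<dots> = (\<Sum>j\<in>UNIV. lam j * h (price (path \<omega>) t) j) + v"
        by (simp add: h_def algebra_simps sum_subtractf sum_distrib_left[symmetric] lam_sum)
      finally have "0 \<le> run (path \<omega>) t * (\<Sum>j\<in>UNIV. lam j * h (price (path \<omega>) t) j)"
        using run_01[of "path \<omega>" t] by auto
      then show "0 \<le> (\<Sum>j\<in>UNIV. lam j * (run (path \<omega>) t * h (price (path \<omega>) t) j))"
        by (simp add: sum_distrib_left mult_ac)
    qed
    also have "\<dots> = expectation (\<lambda>\<omega>. run (path \<omega>) t * h (price (path \<omega>) t) (J (Suc t) \<omega>))"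
    proof (rule expectation_next_arrival[of t "\<lambda>x j. run x t * h (price x t) j", symmetric])
      show "determined_by {1..t} (\<lambda>x. run x t * h (price x t) j)" for j
        unfolding determined_by_def run_def by (metis state_cong)
    qed
    finally show ?thesis .
  qed
  define S where "S \<omega> = (\<Sum>t<T. run (path \<omega>) t * h (price (path \<omega>) t) (J (Suc t) \<omega>))" for \<omega>
  have S_int: "integrable M S"
    unfolding S_def using step_int by (intro Bochner_Integration.integrable_sum) auto
  have "expectation S = (\<Sum>t<T. expectation (\<lambda>\<omega>. run (path \<omega>) t * h (price (path \<omega>) t) (J (Suc t) \<omega>)))"
    unfolding S_def using step_int by (intro Bochner_Integration.integral_sum) auto
  then have "0 \<le> expectation S"
    using step_nonneg by (simp add: sum_nonneg)
  \<comment> \<open>Here \<open>?V\<close> is \<open>real T * v\<close>, the benchmark total in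
    \<open>revenue_lower_bound\<close>.\<close>
  then have "?V - ?R \<le> expectation S + (?V - ?R)"
    by simp
  also have "\<dots> = expectation (\<lambda>\<omega>. S \<omega> + (?V - ?R))"
    using S_int by (simp add: prob_space)
  also have "\<dots> \<le> expectation (\<lambda>\<omega>. alg2_revenue r A C T (path \<omega>))"
  proof (rule integral_mono)
    show "integrable M (\<lambda>\<omega>. S \<omega> + (?V - ?R))"
      using S_int by simp
    show "integrable M (\<lambda>\<omega>. alg2_revenue r A C T (path \<omega>))"
      by (rule integrable_path[OF determined_revenue])
    show "S \<omega> + (?V - ?R) \<le> alg2_revenue r A C T (path \<omega>)" for \<omega>
      using revenue_lower_bound[OF v, of "path \<omega>"] T_pos by (simp add: S_def h_def v_def)
  qed
  finally show ?thesis
    using integrable_path[OF determined_revenue] integrable_path[OF determined_optimum] by simp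
qed

end

section \<open>The asymptotic regime\<close>

theorem theorem1:
  fixes r :: "real^'n" and A :: "real^'n^'m" and lam :: "'n \<Rightarrow> real"
    and Cbar :: "real^'m" and Tbar :: real and k :: "nat \<Rightarrow> real"
    and M :: "'w measure" and J :: "nat \<Rightarrow> 'w \<Rightarrow> 'n"
  assumes r_nonneg: "\<And>j. 0 \<le> r $ j"
    and A_nonneg: "\<And>i j. 0 \<le> A $ i $ j"
    and rows: "\<And>i. \<exists>j. A $ i $ j \<noteq> 0"
    and columns: "\<And>j. \<exists>i. A $ i $ j \<noteq> 0"
    and Cbar_pos: "\<And>i. 0 < Cbar $ i"
    and Tbar_pos: "0 < Tbar"
    and lam_sum: "(\<Sum>j\<in>UNIV. lam j) = 1"
    and prob: "prob_space M"
    and indep: "prob_space.indep_vars M (\<lambda>_. count_space UNIV) J {1..}"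
    and law: "\<And>t j. 1 \<le> t \<Longrightarrow> measure M {\<omega> \<in> space M. J t \<omega> = j} = lam j"
    and scaling: "\<And>T. real T = k T * Tbar"
  shows "(\<lambda>T. prob_space.expectation M (\<lambda>\<omega>.
            hindsight_optimum r A (k T *\<^sub>R Cbar) T (\<lambda>t. J t \<omega>)
            - alg2_revenue r A (k T *\<^sub>R Cbar) T (\<lambda>t. J t \<omega>)))
         \<in> O(\<lambda>T. sqrt (real T) * sqrt (ln (real T)))"
proof -
  \<comment> \<open>The parameters depend on the capacities only through
    \<open>C_max C / C_min C\<close> and \<open>C_max C / real T\<close>, which scaling preserves.
    Computed from \<open>Cbar\<close> and \<open>Tbar\<close>, they give constants independent of
    \<open>T\<close>.\<close>
  define th where "th = theta_bar r A Cbar"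
  define G where "G = C_max Cbar / Tbar * sqrt (real CARD('m)) + a_bar A * sqrt (real CARD('m))"
  define \<eta> where "\<eta> = th * sqrt (real CARD('m)) / G"
  define K where "K = real CARD('m) * (th\<^sup>2 / (2 * \<eta>) + \<eta> * G\<^sup>2)"
  \<comment> \<open>From 3 on, \<open>T\<close> exceeds \<open>exp 1\<close>, so the logarithmic
    factor is at least 1.\<close>
  have "\<forall>\<^sub>F T::nat in sequentially. 3 \<le> T"
    by (rule eventually_ge_at_top)
  then show ?thesis
  proof (intro bigoI[where c = "K + th * a_bar A"], eventually_elim)
    case (elim T)
    have k: "k T = real T / Tbar" "0 < k T"
    proof -
      show "k T = real T / Tbar"
        using scaling[of T] Tbar_pos by simp
      then show "0 < k T"
        using Tbar_pos elim by simp
    qed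
    define C where "C = k T *\<^sub>R Cbar"
    interpret revenue_management r A C T M J lam
      unfolding revenue_management_def iid_arrivals_def revenue_model_def iid_arrivals_axioms_def
      using assms k elim by (auto simp: C_def)
    \<comment> \<open>Lets the positive factor \<open>k T\<close> be pulled out of the maximum and
      minimum of the capacities.\<close>
    have mono: "mono (\<lambda>c. k T * c)"
      using k(2) by (intro monoI mult_left_mono) auto
    have "C_max C = k T * C_max Cbar" "C_min C = k T * C_min Cbar"
      using mono_Max_commute[OF mono, of "range (($) Cbar)"] mono_Min_commute[OF mono, of "range (($) Cbar)"]
      by (simp_all add: C_max_def C_min_def C_def image_image)
    with k elim Tbar_pos have "theta_bar r A C = th" "G_param A C T = G"
      by (simp_all add: th_def theta_bar_def G_def G_param_def)
    then have K: "real CARD('m) * coord_regret = K" and th: "theta_bar r A C = th"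
      by (simp_all add: K_def coord_regret_def \<eta>_def D_param_def)
    have "1 \<le> ln (real T)"
      using exp_le elim by (subst ln_ge_iff) auto
    then have ln: "1 \<le> sqrt (ln (real T))"
      by simp
    let ?E = "expectation (\<lambda>\<omega>. hindsight_optimum r A C T (path \<omega>) - alg2_revenue r A C T (path \<omega>))"
    have nn: "0 \<le> K" "0 \<le> th * a_bar A"
      using coord_regret_nonneg theta_bar_nonneg a_bar_nonneg th by (auto simp: K[symmetric])
    have "0 \<le> ?E"
      by (rule Bochner_Integration.integral_nonneg) (simp add: revenue_le_optimum)
    moreover have "?E \<le> (K + th * a_bar A) * (sqrt (real T) * sqrt (ln (real T)))"
    proof -
      have "?E \<le> K * sqrt (real T) + th * a_bar A * 1"
        using regret_bound[OF lam_sum] by (simp add: K th)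
      \<comment> \<open>The constant term is absorbed into the \<open>sqrt (real T)\<close> term,
        after which the logarithmic factor only enlarges the bound.\<close>
      also have "\<dots> \<le> K * sqrt (real T) + th * a_bar A * sqrt (real T)"
        using nn elim by (intro add_left_mono mult_left_mono) auto
      also have "\<dots> = (K + th * a_bar A) * (sqrt (real T) * 1)"
        by (simp add: algebra_simps)
      also have "\<dots> \<le> (K + th * a_bar A) * (sqrt (real T) * sqrt (ln (real T)))"
        using nn ln by (intro mult_left_mono) auto
      finally show ?thesis .
    qed
    ultimately show ?case
      using ln elim by (simp add: C_def)
  qed
qed

end
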